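(* Let $r_1,r_2\in\mathbb{Z}$ and let $(U_n)_{n\ge0}$ be a sequence of integers with $U_n=r_1U_{n-1}+r_2U_{n-2}$ for all $n\ge2$. Let $\alpha,\beta$ be the roots of $x^2-r_1x-r_2$, assume $\alpha\neq\beta$, and assume $\Delta=(\alpha-\beta)^2=r_1^2+4r_2$ is the square of an integer. Then the sequence $(r_2\operatorname{rad}(\Delta)U_n)_{n\ge1}$ satisfies the Dold condition.
   Context: A sequence of integers $(A_n)_{n\ge1}$ satisfies the Dold condition if $n\mid\sum_{d\mid n}\mu(d)A_{n/d}$ for every $n\in\mathbb{N}_+$ ($\mu$ the Möbius function). For a nonzero integer $m$, $\operatorname{rad}(m)$ denotes the product of the distinct primes dividing $m$. *)

theory Defs
  imports Complex_Main "HOL-Computational_Algebra.Computational_Algebra"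
begin

definition moebius :: "nat \<Rightarrow> int" where
  "moebius n = (if squarefree n then (-1) ^ card (prime_factors n) else 0)"

(* The value A 0 is irrelevant: for n > 0 every index n div d is positive. *)
definition dold :: "(nat \<Rightarrow> int) \<Rightarrow> bool" where
  "dold A \<longleftrightarrow> (\<forall>n>0. int n dvd (\<Sum>d | d dvd n. moebius d * A (n div d)))"

(* Elements of prime_factors m are normalised, i.e. positive primes. *)
definition rad :: "int \<Rightarrow> int" where
  "rad m = \<Prod>(prime_factors m)"

text \<open>The two expressions for the discriminant agree; this also holds for a double root.\<close>

lemma discriminant_eq:
  fixes r1 r2 :: int and \<alpha> \<beta> :: complex
  assumes "{x :: complex. x\<^sup>2 - of_int r1 * x - of_int r2 = 0} = {\<alpha>, \<beta>}"
  shows "(\<alpha> - \<beta>)\<^sup>2 = of_int (r1\<^sup>2 + 4 * r2)"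
proof -
  let ?r = "of_int r1 :: complex" and ?s = "of_int r2 :: complex"
  have root: "x\<^sup>2 - ?r * x - ?s = 0 \<longleftrightarrow> x = \<alpha> \<or> x = \<beta>" for x
    using assms by (auto simp: set_eq_iff)
  have a: "\<alpha>\<^sup>2 - ?r * \<alpha> - ?s = 0"
    using root by blast
  have "(?r - \<alpha>)\<^sup>2 - ?r * (?r - \<alpha>) - ?s = \<alpha>\<^sup>2 - ?r * \<alpha> - ?s"
    by (simp add: power2_eq_square algebra_simps)
  hence A: "?r - \<alpha> = \<alpha> \<or> ?r - \<alpha> = \<beta>"
    using a root[of "?r - \<alpha>"] by simp
  have b: "\<beta>\<^sup>2 - ?r * \<beta> - ?s = 0"
    using root by blast
  have "?r - \<alpha> = \<beta>"
  proof (cases "?r - \<alpha> = \<beta>")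
    case False
    hence r: "?r = 2 * \<alpha>"
      using A by (auto simp: algebra_simps)
    have "(\<beta> - \<alpha>)\<^sup>2 = (\<beta>\<^sup>2 - ?r * \<beta> - ?s) - (\<alpha>\<^sup>2 - ?r * \<alpha> - ?s)"
      by (simp add: r power2_eq_square algebra_simps)
    hence "(\<beta> - \<alpha>)\<^sup>2 = 0"
      by (simp only: a b diff_self)
    thus ?thesis
      using r by simp
  qed
  hence r: "?r = \<alpha> + \<beta>"
    by (simp add: algebra_simps)
  hence s: "?s = - (\<alpha> * \<beta>)"
    using a by (simp add: power2_eq_square algebra_simps)
  show ?thesis
    by (simp add: r s power2_eq_square algebra_simps)
qed

end

theory Submission
  imports Defs "HOL-Number_Theory.Residues"
begin

text \<open>
  A sequence \<open>A\<close> satisfies the Dold condition as soon as \<open>p ^ Suc e\<close> divides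
  \<open>A (p ^ Suc e * m) - A (p ^ e * m)\<close> for every prime \<open>p\<close> not dividing \<open>m\<close>: in the Moebius sum only
  the divisors \<open>d\<close> and \<open>p * d\<close> with \<open>d\<close> dividing \<open>m\<close> contribute, and they pair up with opposite signs.
  As the discriminant is a square, the roots are integers \<open>a\<close> and \<open>b\<close>, and \<open>U\<close> is a linear
  combination of the sequences \<open>b ^ n\<close> and \<open>Q n = (a ^ n - b ^ n) / (a - b)\<close>. Powers satisfy the Dold
  condition, and so \<open>Q\<close> satisfies the congruence at every prime \<open>p\<close> not dividing \<open>a - b\<close>.
  If \<open>p\<close> divides \<open>a - b\<close>, then \<open>p ^ e\<close> divides \<open>Q (p ^ e * m)\<close>, so the congruence
  loses at most one factor \<open>p\<close>, which the radical of the discriminant restores.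
\<close>

section \<open>The quotient of a difference of powers\<close>

primrec power_diff_quotient :: "'a::comm_ring_1 \<Rightarrow> 'a \<Rightarrow> nat \<Rightarrow> 'a" where
  "power_diff_quotient x y 0 = 0"
| "power_diff_quotient x y (Suc n) = y * power_diff_quotient x y n + x ^ n"

lemma power_diff_conv_quotient:
  "x ^ n - y ^ n = (x - y) * power_diff_quotient x y n"
proof (induction n)
  case (Suc n)
  have "x ^ Suc n - y ^ Suc n = y * (x ^ n - y ^ n) + (x - y) * x ^ n"
    by (simp add: algebra_simps)
  also have "\<dots> = (x - y) * power_diff_quotient x y (Suc n)"
    by (simp add: Suc.IH algebra_simps)
  finally show ?case .
qed simp

lemma power_diff_quotient_add:
  "power_diff_quotient x y (m + n) =
    y ^ n * power_diff_quotient x y m + x ^ m * power_diff_quotient x y n"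
  by (induction n) (simp_all add: power_add algebra_simps)

lemma power_diff_quotient_mult:
  "power_diff_quotient x y (n * k) =
    power_diff_quotient x y n * power_diff_quotient (x ^ n) (y ^ n) k"
proof (induction k)
  case (Suc k)
  have "power_diff_quotient x y (n * Suc k) =
      y ^ n * power_diff_quotient x y (n * k) + x ^ (n * k) * power_diff_quotient x y n"
    by (simp add: power_diff_quotient_add[symmetric] add.commute)
  also have "\<dots> = power_diff_quotient x y n * power_diff_quotient (x ^ n) (y ^ n) (Suc k)"
    unfolding Suc.IH power_mult by (simp add: algebra_simps)
  finally show ?case .
qed simp

lemma diff_dvd_power_diff_quotient_Suc:
  "x - y dvd power_diff_quotient x y (Suc n) - of_nat (Suc n) * x ^ n"
proof (induction n)
  case (Suc n)
  have "power_diff_quotient x y (Suc (Suc n)) - of_nat (Suc (Suc n)) * x ^ Suc n =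
      y * (power_diff_quotient x y (Suc n) - of_nat (Suc n) * x ^ n)
      - (x - y) * (of_nat (Suc n) * x ^ n)"
    by (simp add: algebra_simps)
  also have "x - y dvd \<dots>"
    by (intro dvd_diff dvd_mult[OF Suc.IH] dvd_triv_left)
  finally show ?case .
qed simp

lemma of_nat_dvd_power_diff_quotient:
  assumes "of_nat k dvd x - y"
  shows "of_nat k dvd power_diff_quotient x y k"
proof (cases k)
  case (Suc n)
  then have "of_nat k dvd power_diff_quotient x y k - of_nat k * x ^ n"
    using assms diff_dvd_power_diff_quotient_Suc dvd_trans by blast
  then show ?thesis
    by (simp add: dvd_diff_left_iff)
qed simp

lemma of_nat_power_dvd_power_diff_quotient:
  assumes "of_nat k dvd x - y"
  shows "of_nat k ^ e dvd power_diff_quotient x y (k ^ e * m)"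
proof (induction e)
  case (Suc e)
  let ?n = "k ^ e * m"
  have "of_nat k dvd x ^ ?n - y ^ ?n"
    using assms by (simp only: power_diff_conv_quotient dvd_mult2)
  then have "of_nat k dvd power_diff_quotient (x ^ ?n) (y ^ ?n) k"
    by (rule of_nat_dvd_power_diff_quotient)
  with Suc.IH have "of_nat k ^ e * of_nat k dvd
      power_diff_quotient x y ?n * power_diff_quotient (x ^ ?n) (y ^ ?n) k"
    by (rule mult_dvd_mono)
  then show ?case
    by (simp add: power_diff_quotient_mult[symmetric] mult_ac)
qed simp

section \<open>The Dold condition at prime powers\<close>

lemma moebius_prime_mult:
  assumes "prime p" "\<not> p dvd d"
  shows "moebius (p * d) = - moebius d"
proof -
  have "d \<noteq> 0"
    using assms by (metis dvd_0_right)
  have "coprime p d"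
    using assms by (simp add: prime_imp_coprime)
  then have squarefree: "squarefree (p * d) \<longleftrightarrow> squarefree d"
    using assms squarefree_mult_coprime squarefree_multD squarefree_prime by blast
  have "prime_factors (p * d) = insert p (prime_factors d)"
    using assms \<open>d \<noteq> 0\<close> by (subst prime_factors_product) (auto simp: prime_prime_factors)
  moreover have "p \<notin> prime_factors d"
    using assms by auto
  ultimately have "card (prime_factors (p * d)) = Suc (card (prime_factors d))"
    by simp
  then show ?thesis
    by (simp add: moebius_def squarefree)
qed

lemma moebius_eq_0_if_square_dvd:
  assumes "prime p" "p\<^sup>2 dvd d"
  shows "moebius d = 0"
proof -
  have "\<not> squarefree d"
    using assms not_squarefreeI not_prime_unit by blast
  then show ?thesis
    by (simp add: moebius_def)
qed

lemma dvd_prime_power_multE: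
  fixes p d m :: nat
  assumes "prime p" "d dvd p ^ e * m" "\<not> p\<^sup>2 dvd d"
  obtains "d dvd m" | c where "d = p * c" "c dvd m"
proof -
  have coprime_part: "c dvd m" if "c dvd p ^ e * m" "\<not> p dvd c" for c
  proof -
    have "coprime p c"
      using assms(1) that(2) by (rule prime_imp_coprime)
    then have "coprime c (p ^ e)"
      by (simp add: coprime_commute)
    then show ?thesis
      using that(1) by (simp add: coprime_dvd_mult_right_iff)
  qed
  show thesis
  proof (cases "p dvd d")
    case False
    then show thesis
      using assms(2) by (intro that(1) coprime_part)
  next
    case True
    then obtain c where d_eq: "d = p * c" ..
    have "c dvd p ^ e * m"
      using assms(2) unfolding d_eq by (rule dvd_mult_right)
    moreover have "\<not> p dvd c"
      using assms(3) d_eq by (simp add: power2_eq_square)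
    ultimately show thesis
      using d_eq by (intro that(2) coprime_part)
  qed
qed

lemma sum_moebius_prime_power_mult:
  fixes p m :: nat and f :: "nat \<Rightarrow> int"
  assumes "prime p" "\<not> p dvd m"
  shows "(\<Sum>d | d dvd p ^ Suc e * m. moebius d * f d) =
    (\<Sum>d | d dvd m. moebius d * (f d - f (p * d)))"
proof -
  let ?D = "{d. d dvd m}" and ?g = "\<lambda>d. moebius d * f d"
  have "m \<noteq> 0" "p > 0"
    using assms by (auto intro: Nat.gr0I)
  have not_dvd: "\<not> p dvd d" if "d dvd m" for d
    using assms(2) that dvd_trans by blast
  have "sum ?g {d. d dvd p ^ Suc e * m} = sum ?g (?D \<union> (*) p ` ?D)"
  proof (rule sum.mono_neutral_right)
    show "finite {d. d dvd p ^ Suc e * m}"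
      using \<open>m \<noteq> 0\<close> \<open>p > 0\<close> by (intro finite_divisors_nat) simp
    show "?D \<union> (*) p ` ?D \<subseteq> {d. d dvd p ^ Suc e * m}"
      by (auto intro: mult_dvd_mono simp: mult.assoc)
    show "\<forall>d \<in> {d. d dvd p ^ Suc e * m} - (?D \<union> (*) p ` ?D). ?g d = 0"
    proof
      fix d
      assume "d \<in> {d. d dvd p ^ Suc e * m} - (?D \<union> (*) p ` ?D)"
      then have "p\<^sup>2 dvd d"
        using dvd_prime_power_multE[OF \<open>prime p\<close>, of d "Suc e" m] by blast
      then show "?g d = 0"
        using \<open>prime p\<close> by (simp add: moebius_eq_0_if_square_dvd)
    qed
  qed
  also have "\<dots> = sum ?g ?D + sum ?g ((*) p ` ?D)"
    using \<open>m \<noteq> 0\<close> not_dvd by (intro sum.union_disjoint) auto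
  also have "sum ?g ((*) p ` ?D) = (\<Sum>d\<in>?D. ?g (p * d))"
    using \<open>p > 0\<close> by (subst sum.reindex) (auto simp: inj_on_def)
  also have "\<dots> = (\<Sum>d\<in>?D. - moebius d * f (p * d))"
    using \<open>prime p\<close> not_dvd by (intro sum.cong) (auto simp: moebius_prime_mult)
  finally show ?thesis
    by (simp add: sum.distrib[symmetric] algebra_simps)
qed

lemma prime_power_dvd_sum_moebius:
  assumes "prime p" "\<not> p dvd m"
    and congruence: "\<And>k. \<not> p dvd k \<Longrightarrow> int p ^ Suc e dvd A (p ^ Suc e * k) - A (p ^ e * k)"
  shows "int p ^ Suc e dvd (\<Sum>d | d dvd p ^ Suc e * m. moebius d * A (p ^ Suc e * m div d))"
proof -
  let ?n = "p ^ Suc e * m"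
  have "int p ^ Suc e dvd A (?n div d) - A (?n div (p * d))" if "d dvd m" for d
  proof -
    from that obtain k where m_eq: "m = d * k" ..
    then have "\<not> p dvd k" "d > 0"
      using assms(2) by (auto intro: Nat.gr0I)
    moreover have "?n div d = p ^ Suc e * k" "?n div (p * d) = p ^ e * k"
      using m_eq \<open>d > 0\<close> prime_gt_0_nat[OF \<open>prime p\<close>] by (simp_all add: div_mult_swap)
    ultimately show ?thesis
      using congruence by (simp only:)
  qed
  then show ?thesis
    unfolding sum_moebius_prime_power_mult[OF assms(1,2)] by (intro dvd_sum dvd_mult) simp
qed

lemma prime_powers_dvd_imp_dvd:
  fixes x y :: "'a::factorial_semiring"
  assumes "x \<noteq> 0" and "\<And>p. prime p \<Longrightarrow> p ^ multiplicity p x dvd y"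
  shows "x dvd y"
proof (cases "y = 0")
  case False
  have "multiplicity p x \<le> multiplicity p y" if "prime p" for p
  proof (rule multiplicity_geI)
    show "p ^ multiplicity p x dvd y"
      using that by (rule assms(2))
  qed (use that False not_prime_unit in blast)+
  with \<open>x \<noteq> 0\<close> show ?thesis
    by (rule multiplicity_le_imp_dvd)
qed simp

lemma dold_prime_powerI:
  assumes congruence: "\<And>p e m. prime p \<Longrightarrow> \<not> p dvd m \<Longrightarrow>
    int p ^ Suc e dvd A (p ^ Suc e * m) - A (p ^ e * m)"
  shows "dold A"
  unfolding dold_def
proof (intro allI impI)
  fix n :: nat
  assume "n > 0"
  let ?S = "\<Sum>d | d dvd n. moebius d * A (n div d)"
  show "int n dvd ?S"
  proof (rule prime_powers_dvd_imp_dvd)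
    fix q :: int
    assume "prime q"
    then obtain p where q_eq: "q = int p" and "prime p"
      by (metis prime_int_nat_transfer nat_0_le prime_ge_0_int)
    obtain m where decomposition: "n = p ^ multiplicity p n * m" and "\<not> p dvd m"
      using multiplicity_decompose'[of n p] \<open>n > 0\<close> \<open>prime p\<close> not_prime_unit by blast
    have "int n = q ^ multiplicity p n * int m"
      unfolding q_eq by (subst decomposition) simp
    then have multiplicity: "multiplicity q (int n) = multiplicity p n"
      using \<open>\<not> p dvd m\<close> q_eq \<open>prime q\<close> by (intro multiplicity_decomposeI) auto
    show "q ^ multiplicity q (int n) dvd ?S"
    proof (cases "multiplicity p n")
      case (Suc e)
      then have n_eq: "n = p ^ Suc e * m"
        using decomposition by simp
      show ?thesis
        unfolding multiplicity Suc unfolding q_eq n_eq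
        using \<open>prime p\<close> \<open>\<not> p dvd m\<close> congruence[OF \<open>prime p\<close>] by (rule prime_power_dvd_sum_moebius)
    qed (simp add: multiplicity)
  qed (use \<open>n > 0\<close> in simp)
qed

section \<open>Sequences satisfying the Dold condition\<close>

lemma dold_add:
  assumes "dold A" "dold B"
  shows "dold (\<lambda>n. A n + B n)"
  using assms by (simp add: dold_def distrib_left sum.distrib)

lemma dold_mult_left:
  assumes "dold A"
  shows "dold (\<lambda>n. c * A n)"
  using assms by (simp add: dold_def mult.left_commute[of _ c] sum_distrib_left[symmetric])

lemma prime_dvd_power_diff_self:
  fixes x :: int and p :: nat
  assumes "prime p"
  shows "int p dvd x ^ p - x"
proof (cases "int p dvd x")
  case True
  then show ?thesis
    using assms by (intro dvd_diff) (auto intro: dvd_trans[OF _ dvd_power] simp: prime_gt_0_nat)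
next
  case False
  then have "coprime x (int p)"
    using assms by (metis coprime_commute prime_imp_coprime prime_nat_int_transfer)
  moreover have "residues (int p)"
    using assms by unfold_locales (metis of_nat_1 of_nat_less_iff prime_gt_1_nat)
  ultimately have "[x ^ (p - 1) = 1] (mod int p)"
    using assms residues.euler_theorem[of "int p" x] by (simp add: totient_prime)
  then have "[x * x ^ (p - 1) = x * 1] (mod int p)"
    by (intro cong_mult cong_refl)
  then show ?thesis
    using assms by (cases p) (simp_all add: cong_iff_dvd_diff)
qed

lemma prime_power_dvd_power_diff:
  fixes x :: int and p :: nat
  assumes "prime p"
  shows "int p ^ Suc e dvd x ^ (p ^ Suc e * m) - x ^ (p ^ e * m)"
proof -
  have "int p dvd x ^ p - x"
    using assms by (rule prime_dvd_power_diff_self)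
  then have "int p * int p ^ e dvd (x ^ p - x) * power_diff_quotient (x ^ p) x (p ^ e * m)"
    by (intro mult_dvd_mono of_nat_power_dvd_power_diff_quotient)
  then show ?thesis
    by (simp add: power_diff_conv_quotient[symmetric] power_mult[symmetric] mult.assoc)
qed

lemma dold_power: "dold (\<lambda>n. x ^ n)"
  by (intro dold_prime_powerI prime_power_dvd_power_diff)

lemma dold_mult_power_diff_quotient:
  assumes "\<And>p. prime p \<Longrightarrow> p dvd a - b \<Longrightarrow> p dvd c"
  shows "dold (\<lambda>n. c * power_diff_quotient a b n)"
proof (rule dold_prime_powerI)
  fix p e m :: nat
  assume "prime p"
  let ?n = "p ^ Suc e * m" and ?n' = "p ^ e * m" and ?Q = "power_diff_quotient a b"
  have "int p ^ Suc e dvd c * (?Q ?n - ?Q ?n')"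
  proof (cases "int p dvd a - b")
    case True
    have "int p ^ Suc e dvd ?Q ?n" "int p ^ e dvd ?Q ?n'"
      using True by (rule of_nat_power_dvd_power_diff_quotient)+
    then have "int p ^ e dvd ?Q ?n - ?Q ?n'"
      by (auto intro: dvd_diff dest: dvd_mult_right)
    moreover have "int p dvd c"
      using assms \<open>prime p\<close> True by simp
    ultimately show ?thesis
      by (simp add: mult_dvd_mono)
  next
    case False
    have "(a - b) * (?Q ?n - ?Q ?n') = (a ^ ?n - a ^ ?n') - (b ^ ?n - b ^ ?n')"
      using power_diff_conv_quotient[of a ?n b] power_diff_conv_quotient[of a ?n' b]
      by (simp add: algebra_simps)
    also have "int p ^ Suc e dvd \<dots>"
      using \<open>prime p\<close> by (intro dvd_diff prime_power_dvd_power_diff)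
    finally have "int p ^ Suc e dvd (a - b) * (?Q ?n - ?Q ?n')" .
    moreover have "coprime (int p ^ Suc e) (a - b)"
      using \<open>prime p\<close> False by (simp add: prime_imp_coprime del: power_Suc)
    ultimately show ?thesis
      by (simp add: coprime_dvd_mult_right_iff del: power_Suc)
  qed
  then show "int p ^ Suc e dvd c * ?Q ?n - c * ?Q ?n'"
    by (simp only: right_diff_distrib)
qed

section \<open>Recurrences with square discriminant\<close>

lemma linear_recurrence_closed_form:
  fixes a b :: "'a::comm_ring_1" and U :: "nat \<Rightarrow> 'a"
  assumes "\<And>n. U (n + 2) = (a + b) * U (n + 1) - a * b * U n"
  shows "U n = U 0 * b ^ n + (U 1 - b * U 0) * power_diff_quotient a b n"
proof (induction n rule: induct_nat_012)
  case (ge2 n)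
  have "U (Suc (Suc n)) = (a + b) * U (Suc n) - a * b * U n"
    using assms[of n] by simp
  then show ?case
    unfolding ge2 by (simp add: algebra_simps)
qed (simp_all add: algebra_simps)

lemma dold_mult_linear_recurrence:
  assumes recurrence: "\<And>n. U (n + 2) = (a + b) * U (n + 1) - a * b * U n"
    and prime_dvd: "\<And>p. prime p \<Longrightarrow> p dvd a - b \<Longrightarrow> p dvd c"
  shows "dold (\<lambda>n. c * U n)"
proof -
  have decomposition:
    "c * U 0 * b ^ n + (U 1 - b * U 0) * (c * power_diff_quotient a b n) = c * U n" for n
    unfolding linear_recurrence_closed_form[of U a b n, OF recurrence] by (simp add: algebra_simps)
  have "dold (\<lambda>n. c * U 0 * b ^ n + (U 1 - b * U 0) * (c * power_diff_quotient a b n))"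
    using prime_dvd by (intro dold_add dold_mult_left dold_power dold_mult_power_diff_quotient)
  then show ?thesis
    by (simp only: decomposition)
qed

lemma square_discriminant_integer_roots:
  fixes r1 r2 k :: int
  assumes "r1\<^sup>2 + 4 * r2 = k\<^sup>2"
  obtains a b where "r1 = a + b" "r2 = - (a * b)" "k = a - b"
proof -
  have "even (r1\<^sup>2 + 4 * r2) \<longleftrightarrow> even (k\<^sup>2)"
    unfolding assms ..
  then have "even (r1 - k)"
    by simp
  then obtain b where "r1 - k = 2 * b" ..
  then have r1_eq: "r1 = (b + k) + b"
    by simp
  moreover have "r2 = - ((b + k) * b)"
    using assms unfolding r1_eq by (simp add: power2_eq_square algebra_simps)
  ultimately show thesis
    by (rule that) simp
qed

lemma prime_dvd_rad:
  assumes "prime p" "p dvd m" "m \<noteq> 0"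
  shows "p dvd rad m"
proof -
  have "p \<in> prime_factors m"
    using assms by (simp add: in_prime_factors_iff)
  then show ?thesis
    unfolding rad_def by (rule dvd_prodI[OF finite_set_mset])
qed

theorem theorem2:
  fixes r1 r2 \<Delta> :: int and U :: "nat \<Rightarrow> int" and \<alpha> \<beta> :: complex
  assumes recurrence: "\<And>n. n \<ge> 2 \<Longrightarrow> U n = r1 * U (n - 1) + r2 * U (n - 2)"
    and roots: "{x :: complex. x\<^sup>2 - of_int r1 * x - of_int r2 = 0} = {\<alpha>, \<beta>}"
    and distinct: "\<alpha> \<noteq> \<beta>"
    and discriminant: "of_int \<Delta> = (\<alpha> - \<beta>)\<^sup>2"
    and square: "\<exists>k :: int. \<Delta> = k\<^sup>2"
  shows "dold (\<lambda>n. r2 * rad \<Delta> * U n)"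
proof -
  obtain k where \<Delta>_eq: "\<Delta> = k\<^sup>2"
    using square by blast
  have "(of_int \<Delta> :: complex) = of_int (r1\<^sup>2 + 4 * r2)"
    using discriminant discriminant_eq[OF roots] by simp
  then have "r1\<^sup>2 + 4 * r2 = k\<^sup>2"
    unfolding \<Delta>_eq of_int_eq_iff by simp
  then obtain a b where vieta: "r1 = a + b" "r2 = - (a * b)" and k_eq: "k = a - b"
    by (rule square_discriminant_integer_roots)
  show ?thesis
  proof (rule dold_mult_linear_recurrence)
    show "U (n + 2) = (a + b) * U (n + 1) - a * b * U n" for n
      using recurrence[of "n + 2"] by (simp add: vieta)
    have "\<Delta> \<noteq> 0"
      using discriminant distinct by auto
    then show "p dvd r2 * rad \<Delta>" if "prime p" "p dvd a - b" for p
      using that \<Delta>_eq k_eq by (intro dvd_mult prime_dvd_rad) (simp_all add: power2_eq_square)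
  qed
qed

end
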